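(* Let $S$ be a densely defined, closed, symmetric operator in a Hilbert space $\mathcal H$ and let $\{\mathcal G,\Gamma_0,\Gamma_1\}$ be a quasi boundary triple for $T\subset S^*$ with corresponding $\gamma$-field $\gamma$ and Weyl function $M$; let $A_0=T\upharpoonright\ker\Gamma_0$ and $A_1=T\upharpoonright\ker\Gamma_1$. Let $B$ be a linear operator in $\mathcal G$ and assume that there exist $\lambda_+\in\mathbb C^+$ and $\lambda_-\in\mathbb C^-$ such that the following conditions are satisfied (those involving $\lambda_\pm$ being required for both $\lambda_+$ and $\lambda_-$): (i) $B$ is symmetric; (ii) $1\in\rho\bigl(B\overline{M(\lambda_\pm)}\bigr)$; (iii) $B\bigl(\operatorname{ran}\overline{M(\lambda_\pm)}\cap\operatorname{dom}B\bigr)\subset\operatorname{ran}\Gamma_0$; (iv) $\operatorname{ran}\Gamma_1\subset\operatorname{dom}B$; (v) $B(\operatorname{ran}\Gamma_1)\subset\operatorname{ran}\Gamma_0$, or $A_1$ is self-adjoint. Then the operator $$A_{[B]}f=Tf,\qquad \operatorname{dom}A_{[B]}=\bigl\{f\in\operatorname{dom}T:\Gamma_0 f=B\Gamma_1 f\bigr\},$$ is a self-adjoint extension of $S$, and $$(A_{[B]}-\lambda)^{-1}=(A_0-\lambda)^{-1}+\gamma(\lambda)\bigl(I-BM(\lambda)\bigr)^{-1}B\gamma(\overline\lambda)^*$$ holds for all $\lambda\in\rho(A_{[B]})\cap\rho(A_0)$.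
   Context: $\mathbb C^+$ and $\mathbb C^-$ denote the open upper and lower half-planes. Let $S$ be a densely defined, closed, symmetric operator in $\mathcal H$, and let $T\subset S^*$ be a linear operator with $\overline T=S^*$. A triple $\{\mathcal G,\Gamma_0,\Gamma_1\}$ is a quasi boundary triple for $T\subset S^*$ if $\mathcal G$ is a Hilbert space and $\Gamma_0,\Gamma_1:\operatorname{dom}T\to\mathcal G$ are linear maps such that: (1) $(Tf,g)-(f,Tg)=(\Gamma_1f,\Gamma_0g)-(\Gamma_0f,\Gamma_1g)$ for all $f,g\in\operatorname{dom}T$; (2) $(\Gamma_0,\Gamma_1)^\top:\operatorname{dom}T\to\mathcal G\times\mathcal G$ has dense range; (3) $A_0:=T\upharpoonright\ker\Gamma_0$ is self-adjoint in $\mathcal H$. Put $A_1:=T\upharpoonright\ker\Gamma_1$ (not necessarily self-adjoint). For $\lambda\in\rho(A_0)$ one has $\operatorname{dom}T=\ker\Gamma_0\,\dot+\,\ker(T-\lambda)$, so $\Gamma_0\upharpoonright\ker(T-\lambda)$ is injective with range $\operatorname{ran}\Gamma_0$. The $\gamma$-field is $\gamma(\lambda):=(\Gamma_0\upharpoonright\ker(T-\lambda))^{-1}$ (mapping $\operatorname{ran}\Gamma_0\subset\mathcal G$ onto $\ker(T-\lambda)$), and the Weyl function is $M(\lambda):=\Gamma_1\gamma(\lambda)$, an operator in $\mathcal G$ with domain $\operatorname{ran}\Gamma_0$, $\lambda\in\rho(A_0)$. One has $M(\lambda)\subset M(\overline\lambda)^*$, so $M(\lambda)$ is closable; $\overline{M(\lambda)}$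 denotes its closure. The adjoint $\gamma(\lambda)^*$ is bounded and everywhere defined from $\mathcal H$ to $\mathcal G$. *)

theory Defs
  imports "HOL-Analysis.Analysis"
begin

section \<open>Complex Hilbert spaces\<close>

text \<open>
  The scalar product is linear in the first argument. Every complex Hilbert space is a real
  Hilbert space under the real part of its scalar product; building on the class
  \<^class>\<open>real_inner\<close> fixes the norm to be the one induced by the complex scalar product,
  and gives positive definiteness.
\<close>

class complex_vector = real_vector +
  fixes scaleC :: "complex \<Rightarrow> 'a \<Rightarrow> 'a" (infixr "*\<^sub>C" 75)
  assumes scaleC_add_right: "c *\<^sub>C (x + y) = c *\<^sub>C x + c *\<^sub>C y"
    and scaleC_add_left: "(c + d) *\<^sub>C x = c *\<^sub>C x + d *\<^sub>C x"
    and scaleC_scaleC: "c *\<^sub>C d *\<^sub>C x = (c * d) *\<^sub>C x"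
    and scaleR_scaleC: "r *\<^sub>R x = complex_of_real r *\<^sub>C x"

class complex_inner = complex_vector + real_inner +
  fixes cinner :: "'a \<Rightarrow> 'a \<Rightarrow> complex"
  assumes cinner_commute: "cinner x y = cnj (cinner y x)"
    and cinner_add_left: "cinner (x + y) z = cinner x z + cinner y z"
    and cinner_scaleC_left: "cinner (c *\<^sub>C x) y = c * cinner x y"
    and inner_eq_Re_cinner: "inner x y = Re (cinner x y)"

class complex_hilbert_space = complex_inner + complete_space

instantiation complex :: complex_hilbert_space
begin

definition scaleC_complex :: "complex \<Rightarrow> complex \<Rightarrow> complex" where
  "scaleC_complex c x = c * x"

definition cinner_complex :: "complex \<Rightarrow> complex \<Rightarrow> complex" where
  "cinner_complex x y = x * cnj y"

instance
  by standard
    (simp_all add: scaleC_complex_def cinner_complex_def algebra_simps scaleR_conv_of_real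
      inner_complex_def)

end


section \<open>Unbounded operators as graphs\<close>

text \<open>
  An operator with a domain is identified with its graph. Hence the domain, range and inverse
  of an operator are \<^const>\<open>Domain\<close>, \<^const>\<open>Range\<close> and \<^const>\<open>converse\<close>, the image of a set is
  \<^const>\<open>Image\<close>, extension of operators is inclusion, an operator is closed iff its graph is
  \<^const>\<open>closed\<close> in the product topology, and the closure of an operator is the
  \<^const>\<open>closure\<close> of its graph.
\<close>

definition linear_op :: "('a::complex_vector \<times> 'b::complex_vector) set \<Rightarrow> bool" where
  "linear_op A \<longleftrightarrow> single_valued A \<and> (0, 0) \<in> A \<and>
     (\<forall>x y x' y'. (x, y) \<in> A \<longrightarrow> (x', y') \<in> A \<longrightarrow> (x + x', y + y') \<in> A) \<and>
     (\<forall>c x y. (x, y) \<in> A \<longrightarrow> (c *\<^sub>C x, c *\<^sub>C y) \<in> A)"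

definition op_kernel :: "('a \<times> 'b::zero) set \<Rightarrow> 'a set" where
  "op_kernel A = {x. (x, 0) \<in> A}"

definition op_restrict :: "('a \<times> 'b) set \<Rightarrow> 'a set \<Rightarrow> ('a \<times> 'b) set" where
  "op_restrict A D = {(x, y). (x, y) \<in> A \<and> x \<in> D}"

text \<open>Products of operators are read from right to left, opposite to \<^const>\<open>relcomp\<close>.\<close>

definition op_comp :: "('b \<times> 'c) set \<Rightarrow> ('a \<times> 'b) set \<Rightarrow> ('a \<times> 'c) set"
    (infixr "\<circ>\<^sub>o" 75) where
  "A \<circ>\<^sub>o B = B O A"

definition op_plus :: "('a \<times> 'b::plus) set \<Rightarrow> ('a \<times> 'b) set \<Rightarrow> ('a \<times> 'b) set"
    (infixl "+\<^sub>o" 65) where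
  "A +\<^sub>o B = {(x, y + z) | x y z. (x, y) \<in> A \<and> (x, z) \<in> B}"

definition op_minus :: "('a \<times> 'b::minus) set \<Rightarrow> ('a \<times> 'b) set \<Rightarrow> ('a \<times> 'b) set"
    (infixl "-\<^sub>o" 65) where
  "A -\<^sub>o B = {(x, y - z) | x y z. (x, y) \<in> A \<and> (x, z) \<in> B}"

definition scalar_op :: "complex \<Rightarrow> ('a::complex_vector \<times> 'a) set" where
  "scalar_op c = {(x, c *\<^sub>C x) | x. True}"

definition densely_defined :: "('a::topological_space \<times> 'b) set \<Rightarrow> bool" where
  "densely_defined A \<longleftrightarrow> closure (Domain A) = UNIV"

text \<open>For linear \<open>A\<close>, this is the graph of an operator iff \<open>A\<close> is densely defined.\<close>

definition op_adjoint :: "('a::complex_inner \<times> 'b::complex_inner) set \<Rightarrow> ('b \<times> 'a) set" where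
  "op_adjoint A = {(g, g'). \<forall>f f'. (f, f') \<in> A \<longrightarrow> cinner f' g = cinner f g'}"

text \<open>Density of the domain is not part of symmetry.\<close>

definition symmetric_op :: "('a::complex_inner \<times> 'a) set \<Rightarrow> bool" where
  "symmetric_op A \<longleftrightarrow>
     (\<forall>f f' g g'. (f, f') \<in> A \<longrightarrow> (g, g') \<in> A \<longrightarrow> cinner f' g = cinner f g')"

definition selfadjoint_op :: "('a::complex_inner \<times> 'a) set \<Rightarrow> bool" where
  "selfadjoint_op A \<longleftrightarrow> linear_op A \<and> densely_defined A \<and> op_adjoint A = A"

definition bounded_everywhere_defined_op ::
    "('a::complex_inner \<times> 'b::complex_inner) set \<Rightarrow> bool" where
  "bounded_everywhere_defined_op A \<longleftrightarrow> linear_op A \<and> Domain A = UNIV \<and>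
     (\<exists>K. \<forall>x y. (x, y) \<in> A \<longrightarrow> norm y \<le> K * norm x)"

definition resolvent :: "('a::complex_inner \<times> 'a) set \<Rightarrow> complex \<Rightarrow> ('a \<times> 'a) set" where
  "resolvent A \<mu> = (A -\<^sub>o scalar_op \<mu>)\<inverse>"

definition resolvent_set :: "('a::complex_inner \<times> 'a) set \<Rightarrow> complex set" where
  "resolvent_set A = {\<mu>. bounded_everywhere_defined_op (resolvent A \<mu>)}"


section \<open>Quasi boundary triples\<close>

text \<open>The boundary maps \<open>\<Gamma>0\<close> and \<open>\<Gamma>1\<close> are operators with domain \<open>dom T\<close>.\<close>

definition quasi_boundary_triple ::
    "('h::complex_hilbert_space \<times> 'h) set \<Rightarrow> ('h \<times> 'h) set \<Rightarrow>
     ('h \<times> 'g::complex_hilbert_space) set \<Rightarrow> ('h \<times> 'g) set \<Rightarrow> bool" where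
  "quasi_boundary_triple S T \<Gamma>0 \<Gamma>1 \<longleftrightarrow>
     linear_op T \<and> T \<subseteq> op_adjoint S \<and> closure T = op_adjoint S \<and>
     linear_op \<Gamma>0 \<and> Domain \<Gamma>0 = Domain T \<and>
     linear_op \<Gamma>1 \<and> Domain \<Gamma>1 = Domain T \<and>
     (\<forall>f Tf a0 a1 g Tg b0 b1.
        (f, Tf) \<in> T \<longrightarrow> (f, a0) \<in> \<Gamma>0 \<longrightarrow> (f, a1) \<in> \<Gamma>1 \<longrightarrow>
        (g, Tg) \<in> T \<longrightarrow> (g, b0) \<in> \<Gamma>0 \<longrightarrow> (g, b1) \<in> \<Gamma>1 \<longrightarrow>
        cinner Tf g - cinner f Tg = cinner a1 b0 - cinner a0 b1) \<and>
     closure {(a0, a1). \<exists>f. (f, a0) \<in> \<Gamma>0 \<and> (f, a1) \<in> \<Gamma>1} = UNIV \<and>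
     selfadjoint_op (op_restrict T (op_kernel \<Gamma>0))"

definition gamma_field ::
    "('h::complex_vector \<times> 'h) set \<Rightarrow> ('h \<times> 'g) set \<Rightarrow> complex \<Rightarrow> ('g \<times> 'h) set" where
  "gamma_field T \<Gamma>0 \<mu> = (op_restrict \<Gamma>0 (op_kernel (T -\<^sub>o scalar_op \<mu>)))\<inverse>"

definition weyl_function ::
    "('h::complex_vector \<times> 'h) set \<Rightarrow> ('h \<times> 'g) set \<Rightarrow> ('h \<times> 'g) set \<Rightarrow> complex \<Rightarrow>
     ('g \<times> 'g) set" where
  "weyl_function T \<Gamma>0 \<Gamma>1 \<mu> = \<Gamma>1 \<circ>\<^sub>o gamma_field T \<Gamma>0 \<mu>"

text \<open>
  The operator \<open>A\<^bsub>[B]\<^esub>\<close>: the condition \<open>\<Gamma>0 f = B \<Gamma>1 f\<close> includes \<open>\<Gamma>1 f \<in> dom B\<close>.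
\<close>

definition boundary_op ::
    "('h \<times> 'h) set \<Rightarrow> ('h \<times> 'g) set \<Rightarrow> ('h \<times> 'g) set \<Rightarrow> ('g \<times> 'g) set \<Rightarrow> ('h \<times> 'h) set" where
  "boundary_op T \<Gamma>0 \<Gamma>1 B =
     op_restrict T {f. \<exists>\<phi>. (f, \<phi>) \<in> \<Gamma>0 \<and> (f, \<phi>) \<in> B \<circ>\<^sub>o \<Gamma>1}"

end

theory Submission
  imports Defs
begin

text \<open>
  Write \<open>AB\<close> for the operator with boundary condition \<open>\<Gamma>0 f = B (\<Gamma>1 f)\<close>. Green's identity and the
  symmetry of \<open>B\<close> make \<open>AB\<close> symmetric. The operator \<open>S\<close> is a restriction of \<open>AB\<close>, since both
  boundary values vanish on \<open>dom S\<close> (\<open>minimal_operator\<close>), and so \<open>AB\<close> is densely defined.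
  What remains is a range condition: a densely defined symmetric operator \<open>A\<close> is self-adjoint as soon
  as \<open>A - c\<close> is onto for one \<open>c\<close> in each half-plane (\<open>selfadjoint_opI\<close>). The two points need not be
  conjugate, as surjectivity of \<open>A - c\<close> spreads over the half-plane that contains \<open>c\<close>: the inverse has
  norm at most \<open>1 / \<bar>Im c\<bar>\<close>, and nearby points are reached by a contraction argument.

  To solve \<open>(AB - c) f = h\<close> (\<open>surj_AB\<close>), put \<open>k = (A0 - c)\<inverse> h\<close>, which exists because \<open>A0\<close> is
  self-adjoint and \<open>c\<close> is not real. Every solution of \<open>(T - c) f = h\<close> is \<open>k + \<gamma> c a\<close> for some
  \<open>a \<in> ran \<Gamma>0\<close>, with \<open>\<Gamma>0 f = a\<close> and \<open>\<Gamma>1 f = \<Gamma>1 k + M c a\<close>, so that the boundary condition becomes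
  \<open>a = B (\<Gamma>1 k + M c a)\<close>. With \<open>M c\<close> replaced by its closure this has a solution \<open>a\<close> in the boundary
  space, as \<open>1\<close> is in the resolvent set of \<open>B\<close> times the closure. Both \<open>B (\<Gamma>1 k)\<close> and \<open>B\<close> applied to
  a value of the closure lie in \<open>ran \<Gamma>0\<close>; so \<open>a \<in> ran \<Gamma>0\<close>, and on this set the closure agrees with
  \<open>M c\<close> because \<open>M c\<close> is closable. If \<open>B\<close> is not assumed to map \<open>ran \<Gamma>1\<close> into \<open>ran \<Gamma>0\<close> but \<open>A1\<close> is
  self-adjoint, then \<open>dom T\<close> is the sum of \<open>ker \<Gamma>1\<close> and \<open>ker (T - c)\<close>; hence \<open>ran \<Gamma>1\<close> is the range
  of \<open>M c\<close>, and the mapping property of \<open>B\<close> on the range of the closure covers this case as well.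

  The same decomposition gives Krein's formula (\<open>krein_formula\<close>) for every \<open>c\<close> in the resolvent set
  of \<open>A0\<close>, once \<open>\<Gamma>1 (A0 - c)\<inverse>\<close> is recognised as the adjoint of \<open>\<gamma> (cnj c)\<close>. That \<open>I - B (M c)\<close> is
  injective is where \<open>c\<close> must not be an eigenvalue of \<open>AB\<close>.
\<close>

section \<open>Complex Hilbert spaces\<close>

lemma scaleC_one [simp]: "1 *\<^sub>C x = (x :: 'a::complex_vector)"
  using scaleR_scaleC[of 1 x] by simp

lemma scaleC_zero_right [simp]: "c *\<^sub>C 0 = (0 :: 'a::complex_vector)"
  using scaleC_add_right[of c 0 0] by simp

lemma scaleC_minus_one [simp]: "(-1) *\<^sub>C x = - (x :: 'a::complex_vector)"
  using scaleR_scaleC[of "-1" x] by simp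

lemma scaleC_minus_right: "c *\<^sub>C (- x) = - (c *\<^sub>C (x :: 'a::complex_vector))"
  using scaleC_add_right[of c x "- x"] by (simp add: eq_neg_iff_add_eq_0 add.commute)

lemma scaleC_diff_right: "c *\<^sub>C (x - y) = c *\<^sub>C x - c *\<^sub>C (y :: 'a::complex_vector)"
  using scaleC_add_right[of c x "- y"] by (simp add: scaleC_minus_right)

lemma scaleC_diff_left: "(c - d) *\<^sub>C x = c *\<^sub>C x - d *\<^sub>C (x :: 'a::complex_vector)"
  using scaleC_add_left[of "c - d" d x] by (simp add: algebra_simps)

lemma cinner_zero_left [simp]: "cinner 0 x = 0"
  using cinner_add_left[of 0 0 x] by simp

lemma cinner_zero_right [simp]: "cinner x 0 = 0"
  using cinner_commute[of x 0] by simp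

lemma cinner_diff_left: "cinner (x - y) z = cinner x z - cinner y z"
  using cinner_add_left[of "x - y" y z] by simp

lemma cinner_add_right: "cinner x (y + z) = cinner x y + cinner x z"
  using cinner_commute[of x "y + z"] cinner_commute[of y x] cinner_commute[of z x]
  by (simp add: cinner_add_left)

lemma cinner_diff_right: "cinner x (y - z) = cinner x y - cinner x z"
  using cinner_add_right[of x "y - z" z] by simp

lemma cinner_scaleC_right: "cinner x (c *\<^sub>C y) = cnj c * cinner x y"
  using cinner_commute[of x "c *\<^sub>C y"] cinner_commute[of y x] by (simp add: cinner_scaleC_left)

lemma Im_cinner: "Im (cinner x y) = inner x (\<i> *\<^sub>C y)"
  by (simp add: inner_eq_Re_cinner cinner_scaleC_right)

lemma cinner_self: "cinner x x = complex_of_real ((norm x)\<^sup>2)"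
proof (rule complex_eqI)
  show "Re (cinner x x) = Re (complex_of_real ((norm x)\<^sup>2))"
    by (simp flip: inner_eq_Re_cinner add: power2_norm_eq_inner)
  show "Im (cinner x x) = Im (complex_of_real ((norm x)\<^sup>2))"
    using arg_cong[OF cinner_commute[of x x], of Im] by simp
qed

lemma cinner_self_eq_0 [simp]: "cinner x x = 0 \<longleftrightarrow> x = 0"
  by (simp add: cinner_self)

lemma norm_scaleC: "norm (c *\<^sub>C x) = cmod c * norm (x :: 'a::complex_inner)"
proof -
  have "complex_of_real ((norm (c *\<^sub>C x))\<^sup>2) = complex_of_real ((cmod c * norm x)\<^sup>2)"
    unfolding cinner_self[symmetric] cinner_scaleC_left cinner_scaleC_right
    by (simp add: cinner_self complex_norm_square[unfolded of_real_power] power_mult_distrib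
        mult.assoc mult.commute)
  then show ?thesis
    by (simp only: of_real_eq_iff) (simp add: power2_eq_iff_nonneg)
qed

lemma bounded_linear_scaleC: "bounded_linear (\<lambda>x :: 'a::complex_inner. c *\<^sub>C x)"
  by (rule bounded_linear_intro[of _ "cmod c"])
    (simp_all add: scaleC_add_right norm_scaleC scaleR_scaleC scaleC_scaleC mult.commute)

lemmas tendsto_scaleC [tendsto_intros] = bounded_linear.tendsto[OF bounded_linear_scaleC]
lemmas continuous_on_scaleC [continuous_intros] =
  bounded_linear.continuous_on[OF bounded_linear_scaleC]

text \<open>
  Both parts of the complex scalar product are real scalar products, so that continuity is
  inherited from the real one.
\<close>

lemma cinner_eq_Complex: "cinner x y = Complex (inner x y) (inner x (\<i> *\<^sub>C y))"
  by (simp add: complex_eq_iff Im_cinner inner_eq_Re_cinner)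

lemma continuous_on_cinner [continuous_intros]:
  "continuous_on S f \<Longrightarrow> continuous_on S g \<Longrightarrow> continuous_on S (\<lambda>x. cinner (f x) (g x))"
  unfolding cinner_eq_Complex by (intro continuous_intros)

lemma orthogonal_to_dense_set:
  fixes u :: "'a::complex_inner"
  assumes "closure D = UNIV" and "\<And>d. d \<in> D \<Longrightarrow> cinner d u = 0"
  shows "u = 0"
proof -
  have "closed {d. cinner d u = 0}"
    by (intro closed_Collect_eq continuous_intros)
  then have "closure D \<subseteq> {d. cinner d u = 0}"
    using assms(2) by (intro closure_minimal) auto
  then have "cinner u u = 0"
    using assms(1) by blast
  then show ?thesis by simp
qed

text \<open>
  The nearest point: by the parallelogram law a sequence in \<open>V\<close> whose distances to \<open>x\<close> approach the
  infimum is Cauchy, and moving from its limit along \<open>w\<close> cannot decrease the distance.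
\<close>

lemma orthogonal_projection_exists:
  fixes V :: "'a::{real_inner, complete_space} set"
  assumes V: "subspace V" "closed V"
  shows "\<exists>v\<in>V. \<forall>w\<in>V. inner (x - v) w = 0"
proof -
  define d where "d = infdist x V"
  have ne: "V \<noteq> {}" and d0: "d \<ge> 0"
    using subspace_0[OF V(1)] by (auto simp: d_def infdist_nonneg)
  have low: "d\<^sup>2 \<le> (norm (x - v))\<^sup>2" if "v \<in> V" for v
    using infdist_le[OF that, of x] d0 by (auto simp: d_def dist_norm intro: power_mono)
  have "\<exists>v\<in>V. (norm (x - v))\<^sup>2 < d\<^sup>2 + e" if e: "e > 0" for e
  proof -
    have "d < sqrt (d\<^sup>2 + e)"
      using d0 e by (intro real_less_rsqrt) auto
    then have "(INF v\<in>V. dist x v) < sqrt (d\<^sup>2 + e)"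
      using ne by (simp add: d_def infdist_notempty)
    then obtain v where v: "v \<in> V" "dist x v < sqrt (d\<^sup>2 + e)"
      using cInf_lessD[of "dist x ` V"] ne by blast
    have "(norm (x - v))\<^sup>2 < (sqrt (d\<^sup>2 + e))\<^sup>2"
      using v(2) by (intro power_strict_mono) (auto simp: dist_norm)
    then show ?thesis using v e d0 by auto
  qed
  then have "\<forall>n. \<exists>v\<in>V. (norm (x - v))\<^sup>2 < d\<^sup>2 + inverse (real (Suc n))"
    by simp
  then obtain v where v: "\<And>n. v n \<in> V"
      and near: "\<And>n. (norm (x - v n))\<^sup>2 < d\<^sup>2 + inverse (real (Suc n))"
    by metis
  have diff: "(norm (v m - v n))\<^sup>2 \<le> 2 * inverse (real (Suc m)) + 2 * inverse (real (Suc n))"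
    for m n
  proof -
    let ?a = "x - v m" and ?b = "x - v n" and ?c = "x - (1/2) *\<^sub>R (v m + v n)"
    have "(norm (v m - v n))\<^sup>2 = 2 * (norm ?a)\<^sup>2 + 2 * (norm ?b)\<^sup>2 - 4 * (norm ?c)\<^sup>2"
      unfolding power2_norm_eq_inner
      by (simp add: inner_diff_left inner_diff_right inner_add_left inner_add_right inner_commute
          field_simps)
    moreover have "d\<^sup>2 \<le> (norm ?c)\<^sup>2"
      using v V(1) by (intro low subspace_scale subspace_add)
    ultimately show ?thesis using near[of m] near[of n] by argo
  qed
  have "Cauchy v"
  proof (rule metric_CauchyI)
    fix e :: real assume "e > 0"
    then obtain N where N: "inverse (real (Suc N)) < e\<^sup>2 / 4"
      using reals_Archimedean[of "e\<^sup>2 / 4"] by auto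
    show "\<exists>N. \<forall>m\<ge>N. \<forall>n\<ge>N. dist (v m) (v n) < e"
    proof (intro exI allI impI)
      fix m n assume mn: "m \<ge> N" "n \<ge> N"
      have "inverse (real (Suc m)) \<le> inverse (real (Suc N))"
           "inverse (real (Suc n)) \<le> inverse (real (Suc N))"
        using mn by (auto intro!: le_imp_inverse_le)
      then have "(norm (v m - v n))\<^sup>2 < e\<^sup>2"
        using diff[of m n] N by linarith
      then show "dist (v m) (v n) < e"
        using \<open>e > 0\<close> by (auto simp: dist_norm intro: power_less_imp_less_base)
    qed
  qed
  then obtain l where l: "v \<longlonglongrightarrow> l"
    using Cauchy_convergent convergent_def by blast
  have lV: "l \<in> V"
    using closed_sequentially[OF V(2) _ l] v by blast
  have "(\<lambda>n. (norm (x - v n))\<^sup>2) \<longlonglongrightarrow> (norm (x - l))\<^sup>2"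
    by (intro tendsto_intros l)
  moreover have "(\<lambda>n. d\<^sup>2 + inverse (real (Suc n))) \<longlonglongrightarrow> d\<^sup>2 + 0"
    by (intro tendsto_intros LIMSEQ_inverse_real_of_nat)
  ultimately have min: "(norm (x - l))\<^sup>2 \<le> d\<^sup>2"
    using near by (simp add: LIMSEQ_le less_imp_le)
  have "inner (x - l) w = 0" if w: "w \<in> V" for w
  proof (rule ccontr)
    assume p: "inner (x - l) w \<noteq> 0"
    then have w0: "inner w w > 0" by auto
    \<comment> \<open>the minimiser of the distance on the line \<open>l + t w\<close>\<close>
    define t where "t = inner (x - l) w / inner w w"
    have "(norm (x - l))\<^sup>2 \<le> (norm (x - (l + t *\<^sub>R w)))\<^sup>2"
      using min low[of "l + t *\<^sub>R w"] lV w V(1)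
      by (meson order_trans subspace_add subspace_scale)
    also have "(norm (x - (l + t *\<^sub>R w)))\<^sup>2 =
        (norm (x - l))\<^sup>2 - 2 * t * inner (x - l) w + t\<^sup>2 * inner w w"
      unfolding power2_norm_eq_inner
      by (simp add: inner_diff_left inner_diff_right inner_add_left inner_add_right inner_commute
          algebra_simps power2_eq_square)
    also have "\<dots> = (norm (x - l))\<^sup>2 - (inner (x - l) w)\<^sup>2 / inner w w"
      using w0 by (simp add: t_def power2_eq_square field_simps)
    finally show False
      using p w0 by (simp add: divide_le_0_iff)
  qed
  then show ?thesis using lV by blast
qed


section \<open>Graphs of linear operators\<close>

lemma linear_op_unique: "linear_op A \<Longrightarrow> (x, y) \<in> A \<Longrightarrow> (x, z) \<in> A \<Longrightarrow> y = z"
  by (auto simp: linear_op_def dest: single_valuedD)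

lemma linear_op_zero: "linear_op A \<Longrightarrow> (0, 0) \<in> A"
  by (simp add: linear_op_def)

lemma linear_op_add:
  "linear_op A \<Longrightarrow> (x, y) \<in> A \<Longrightarrow> (x', y') \<in> A \<Longrightarrow> (x + x', y + y') \<in> A"
  by (simp add: linear_op_def)

lemma linear_op_scaleC: "linear_op A \<Longrightarrow> (x, y) \<in> A \<Longrightarrow> (c *\<^sub>C x, c *\<^sub>C y) \<in> A"
  by (simp add: linear_op_def)

lemma linear_op_diff:
  assumes "linear_op A" "(x, y) \<in> A" "(x', y') \<in> A"
  shows "(x - x', y - y') \<in> A"
  using linear_op_add[OF assms(1,2) linear_op_scaleC[OF assms(1,3), of "-1"]] by simp

lemma op_minus_scalar_op_iff [simp]:
  fixes A :: "('a::complex_vector \<times> 'a) set"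
  shows "(x, z) \<in> A -\<^sub>o scalar_op c \<longleftrightarrow> (x, z + c *\<^sub>C x) \<in> A"
proof
  show "(x, z + c *\<^sub>C x) \<in> A" if "(x, z) \<in> A -\<^sub>o scalar_op c"
    using that by (auto simp: op_minus_def scalar_op_def)
  show "(x, z) \<in> A -\<^sub>o scalar_op c" if "(x, z + c *\<^sub>C x) \<in> A"
    unfolding op_minus_def scalar_op_def
    using that by (simp, intro exI[of _ "z + c *\<^sub>C x"]) simp
qed

lemma Range_op_minus_scalar_op:
  fixes A :: "('a::complex_vector \<times> 'a) set"
  shows "h \<in> Range (A -\<^sub>o scalar_op c) \<longleftrightarrow> (\<exists>f. (f, h + c *\<^sub>C f) \<in> A)"
  by (simp add: Range_iff)

lemma one_minus_op_iff:
  fixes A :: "('a::complex_vector \<times> 'a) set"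
  shows "(x, y) \<in> scalar_op 1 -\<^sub>o A \<longleftrightarrow> (x, x - y) \<in> A"
proof
  show "(x, x - y) \<in> A" if "(x, y) \<in> scalar_op 1 -\<^sub>o A"
    using that by (auto simp: op_minus_def scalar_op_def)
  show "(x, y) \<in> scalar_op 1 -\<^sub>o A" if "(x, x - y) \<in> A"
    unfolding op_minus_def scalar_op_def
    using that by (simp, intro exI[of _ "x - y"]) simp
qed

lemma op_restrict_iff [simp]: "(x, y) \<in> op_restrict A D \<longleftrightarrow> (x, y) \<in> A \<and> x \<in> D"
  by (simp add: op_restrict_def)

lemma op_kernel_iff [simp]: "x \<in> op_kernel A \<longleftrightarrow> (x, 0) \<in> A"
  by (simp add: op_kernel_def)

lemma op_comp_iff: "(x, z) \<in> A \<circ>\<^sub>o B \<longleftrightarrow> (\<exists>y. (x, y) \<in> B \<and> (y, z) \<in> A)"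
  by (auto simp: op_comp_def)

lemma resolvent_iff: "(z, x) \<in> resolvent A c \<longleftrightarrow> (x, z + c *\<^sub>C x) \<in> A"
  by (simp add: resolvent_def)

lemma resolvent_set_surj:
  assumes "c \<in> resolvent_set A"
  shows "\<exists>x. (x, z + c *\<^sub>C x) \<in> A"
proof -
  have "z \<in> Domain (resolvent A c)"
    using assms by (simp add: resolvent_set_def bounded_everywhere_defined_op_def)
  then show ?thesis by (auto simp: resolvent_iff)
qed

lemma resolvent_set_inj:
  assumes "c \<in> resolvent_set A" "(x, c *\<^sub>C x) \<in> A"
  shows "x = 0"
proof -
  have "linear_op (resolvent A c)"
    using assms(1) by (simp add: resolvent_set_def bounded_everywhere_defined_op_def)
  moreover have "(0, x) \<in> resolvent A c"
    using assms(2) by (simp add: resolvent_iff)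
  ultimately show ?thesis
    using linear_op_zero linear_op_unique by metis
qed


section \<open>Symmetric and self-adjoint operators\<close>

lemma closed_op_adjoint: "closed (op_adjoint A)"
proof -
  have "op_adjoint A = (\<Inter>p\<in>A. {q. cinner (snd p) (fst q) = cinner (fst p) (snd q)})"
    by (force simp: op_adjoint_def)
  moreover have "closed (\<Inter>p\<in>A. {q. cinner (snd p) (fst q) = cinner (fst p) (snd q)})"
    by (intro closed_INT ballI closed_Collect_eq continuous_intros)
  ultimately show ?thesis by simp
qed

lemma op_adjoint_unique:
  assumes "densely_defined A" "(g, g1) \<in> op_adjoint A" "(g, g2) \<in> op_adjoint A"
  shows "g1 = g2"
proof -
  have "g1 - g2 = 0"
  proof (rule orthogonal_to_dense_set)
    show "closure (Domain A) = UNIV"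
      using assms(1) by (simp add: densely_defined_def)
    show "cinner x (g1 - g2) = 0" if "x \<in> Domain A" for x
      using that assms(2,3) by (force simp: op_adjoint_def cinner_diff_right)
  qed
  then show ?thesis by simp
qed

lemma selfadjoint_op_symmetric: "selfadjoint_op A \<Longrightarrow> symmetric_op A"
  unfolding selfadjoint_op_def symmetric_op_def op_adjoint_def by blast

text \<open>
  Since \<open>(A f, f)\<close> is real, the imaginary part of \<open>((A - c) f, f)\<close> is \<open>- Im c \<parallel>f\<parallel>\<^sup>2\<close>.
\<close>

lemma symmetric_op_lower_bound:
  assumes A: "symmetric_op A" and f: "(f, h + c *\<^sub>C f) \<in> A"
  shows "\<bar>Im c\<bar> * norm f \<le> norm h"
proof (cases "f = 0")
  case False
  have "cinner (h + c *\<^sub>C f) f = cnj (cinner (h + c *\<^sub>C f) f)"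
    using A f cinner_commute unfolding symmetric_op_def by metis
  then have "Im (cinner (h + c *\<^sub>C f) f) = 0"
    by (metis cnj.sel(2) neg_equal_zero)
  then have "Im (cinner h f) = - (Im c * (norm f)\<^sup>2)"
    by (simp add: cinner_add_left cinner_scaleC_left cinner_self)
  then have "\<bar>Im c\<bar> * (norm f)\<^sup>2 = \<bar>inner h (\<i> *\<^sub>C f)\<bar>"
    by (simp add: Im_cinner abs_mult)
  also have "\<dots> \<le> norm h * norm (\<i> *\<^sub>C f)"
    by (rule Cauchy_Schwarz_ineq2)
  finally have "(\<bar>Im c\<bar> * norm f) * norm f \<le> norm h * norm f"
    by (simp add: norm_scaleC power2_eq_square mult.assoc)
  then show ?thesis using False by simp
qed simp

text \<open>
  By the lower bound, convergence of \<open>(A - c) f\<^sub>n\<close> forces convergence of \<open>f\<^sub>n\<close>.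
\<close>

lemma closed_range_of_symmetric_op:
  fixes A :: "('a::complex_hilbert_space \<times> 'a) set"
  assumes lin: "linear_op A" and sym: "symmetric_op A" and cl: "closed A" and c: "Im c \<noteq> 0"
  shows "closed (Range (A -\<^sub>o scalar_op c))"
proof (subst closed_sequential_limits, intro allI impI, elim conjE)
  fix h l assume "\<forall>n. h n \<in> Range (A -\<^sub>o scalar_op c)" and hl: "h \<longlonglongrightarrow> l"
  then have "\<forall>n. \<exists>f. (f, h n + c *\<^sub>C f) \<in> A"
    by (simp add: Range_op_minus_scalar_op)
  then obtain f where f: "\<And>n. (f n, h n + c *\<^sub>C f n) \<in> A" by metis
  have bound: "\<bar>Im c\<bar> * norm (f m - f n) \<le> norm (h m - h n)" for m n
  proof (rule symmetric_op_lower_bound[OF sym])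
    show "(f m - f n, (h m - h n) + c *\<^sub>C (f m - f n)) \<in> A"
      using linear_op_diff[OF lin f[of m] f[of n]] by (simp add: scaleC_diff_right algebra_simps)
  qed
  have "Cauchy f"
  proof (rule metric_CauchyI)
    fix e :: real assume "e > 0"
    then have "\<bar>Im c\<bar> * e > 0" using c by simp
    then obtain N where N: "\<And>m n. m \<ge> N \<Longrightarrow> n \<ge> N \<Longrightarrow> dist (h m) (h n) < \<bar>Im c\<bar> * e"
      using metric_CauchyD[OF LIMSEQ_imp_Cauchy[OF hl]] by metis
    have "dist (f m) (f n) < e" if "m \<ge> N" "n \<ge> N" for m n
    proof -
      have "\<bar>Im c\<bar> * dist (f m) (f n) < \<bar>Im c\<bar> * e"
        using bound[of m n] N[OF that] by (simp add: dist_norm)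
      then show ?thesis using c by simp
    qed
    then show "\<exists>N. \<forall>m\<ge>N. \<forall>n\<ge>N. dist (f m) (f n) < e" by blast
  qed
  then obtain k where k: "f \<longlonglongrightarrow> k"
    using Cauchy_convergent convergent_def by blast
  have "(\<lambda>n. (f n, h n + c *\<^sub>C f n)) \<longlonglongrightarrow> (k, l + c *\<^sub>C k)"
    by (intro tendsto_intros k hl)
  then have "(k, l + c *\<^sub>C k) \<in> A"
    by (intro closed_sequentially[OF cl f])
  then show "l \<in> Range (A -\<^sub>o scalar_op c)" by auto
qed

text \<open>
  The range of \<open>A - c\<close> is closed, and a vector orthogonal to it is an eigenvector of the adjoint,
  that is, of \<open>A\<close>, for the non-real eigenvalue \<open>cnj c\<close>.
\<close>

lemma selfadjoint_op_surj:
  fixes A :: "('a::complex_hilbert_space \<times> 'a) set"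
  assumes A: "selfadjoint_op A" and c: "Im c \<noteq> 0"
  shows "\<exists>f. (f, h + c *\<^sub>C f) \<in> A"
proof -
  have lin: "linear_op A" and adj: "op_adjoint A = A" and sym: "symmetric_op A"
    using A selfadjoint_op_symmetric by (auto simp: selfadjoint_op_def)
  let ?V = "Range (A -\<^sub>o scalar_op c)"
  have scale: "d *\<^sub>C w \<in> ?V" if "w \<in> ?V" for d w
  proof -
    from that obtain f where "(f, w + c *\<^sub>C f) \<in> A" by auto
    from linear_op_scaleC[OF lin this, of d]
    have "(d *\<^sub>C f, d *\<^sub>C w + c *\<^sub>C (d *\<^sub>C f)) \<in> A"
      by (simp add: scaleC_add_right scaleC_scaleC mult.commute)
    then show ?thesis by auto
  qed
  have "subspace ?V"
    unfolding subspace_def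
  proof (intro conjI ballI allI)
    show "0 \<in> ?V" 
      using linear_op_zero[OF lin] unfolding Range_op_minus_scalar_op by (intro exI[of _ 0]) simp
    show "r *\<^sub>R w \<in> ?V" if "w \<in> ?V" for r w
      using scale[OF that] by (simp add: scaleR_scaleC)
    fix v w assume "v \<in> ?V" "w \<in> ?V"
    then obtain f g where "(f, v + c *\<^sub>C f) \<in> A" "(g, w + c *\<^sub>C g) \<in> A" by auto
    from linear_op_add[OF lin this]
    have "(f + g, (v + w) + c *\<^sub>C (f + g)) \<in> A"
      by (simp add: scaleC_add_right algebra_simps)
    then show "v + w \<in> ?V" by auto
  qed
  moreover have "closed ?V"
    using closed_range_of_symmetric_op[OF lin sym _ c] closed_op_adjoint[of A] adj by simp
  ultimately obtain v where v: "v \<in> ?V" and orth: "\<And>w. w \<in> ?V \<Longrightarrow> inner (h - v) w = 0"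
    using orthogonal_projection_exists by metis
  let ?u = "h - v"
  have corth: "cinner w ?u = 0" if "w \<in> ?V" for w
  proof -
    have "cinner ?u w = 0"
      using orth[OF that] orth[OF scale[OF that, of \<i>]]
      by (simp add: cinner_eq_Complex complex_eq_iff)
    then show ?thesis using cinner_commute[of w ?u] by simp
  qed
  have "(?u, cnj c *\<^sub>C ?u) \<in> op_adjoint A"
    unfolding op_adjoint_def
  proof (clarify)
    fix f f' assume "(f, f') \<in> A"
    then have "\<exists>g. (g, (f' - c *\<^sub>C f) + c *\<^sub>C g) \<in> A"
      by (intro exI[of _ f]) simp
    then have "cinner (f' - c *\<^sub>C f) ?u = 0"
      unfolding Range_op_minus_scalar_op[symmetric] by (rule corth)
    then show "cinner f' ?u = cinner f (cnj c *\<^sub>C ?u)"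
      by (simp only: cinner_diff_left cinner_scaleC_left cinner_scaleC_right) simp
  qed
  then have "\<bar>Im (cnj c)\<bar> * norm ?u \<le> norm (0 :: 'a)"
    unfolding adj by (intro symmetric_op_lower_bound[OF sym]) simp
  then have "?u = 0"
    using c by (simp add: mult_le_0_iff)
  then have "h \<in> ?V" using v by simp
  then show ?thesis unfolding Range_op_minus_scalar_op .
qed

text \<open>
  The equation \<open>(A - d) f = h\<close> reads \<open>f = (A - c)\<inverse> (h + (d - c) f)\<close>, and the inverse has norm at
  most \<open>1 / \<bar>Im c\<bar>\<close>, so that the right-hand side is a contraction in \<open>f\<close>.
\<close>

lemma symmetric_op_surj_nearby:
  fixes A :: "('a::complex_hilbert_space \<times> 'a) set"
  assumes lin: "linear_op A" and sym: "symmetric_op A"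
    and surj: "\<And>h. \<exists>f. (f, h + c *\<^sub>C f) \<in> A" and d: "cmod (d - c) < \<bar>Im c\<bar>"
  shows "\<exists>f. (f, h + d *\<^sub>C f) \<in> A"
proof -
  have c: "\<bar>Im c\<bar> > 0" using d norm_ge_zero[of "d - c"] by linarith
  from surj obtain R where R: "\<And>k. (R k, k + c *\<^sub>C R k) \<in> A" by metis
  have bound: "\<bar>Im c\<bar> * norm (R x - R y) \<le> norm (x - y)" for x y
  proof (rule symmetric_op_lower_bound[OF sym])
    show "(R x - R y, (x - y) + c *\<^sub>C (R x - R y)) \<in> A"
      using linear_op_diff[OF lin R[of x] R[of y]] by (simp add: scaleC_diff_right algebra_simps)
  qed
  have "\<exists>!f. R (h + (d - c) *\<^sub>C f) = f"
  proof (rule banach_fix_type[of "cmod (d - c) / \<bar>Im c\<bar>"])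
    show "\<forall>x y. dist (R (h + (d - c) *\<^sub>C x)) (R (h + (d - c) *\<^sub>C y))
        \<le> cmod (d - c) / \<bar>Im c\<bar> * dist x y"
    proof (intro allI)
      fix x y
      have "\<bar>Im c\<bar> * norm (R (h + (d - c) *\<^sub>C x) - R (h + (d - c) *\<^sub>C y))
          \<le> cmod (d - c) * norm (x - y)"
        using bound[of "h + (d - c) *\<^sub>C x" "h + (d - c) *\<^sub>C y"]
        by (simp flip: scaleC_diff_right add: norm_scaleC)
      then show "dist (R (h + (d - c) *\<^sub>C x)) (R (h + (d - c) *\<^sub>C y))
          \<le> cmod (d - c) / \<bar>Im c\<bar> * dist x y"
        using c by (simp add: dist_norm field_simps)
    qed
  qed (use c d in auto)
  then obtain f where "R (h + (d - c) *\<^sub>C f) = f" by blast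
  then have "(f, h + (d - c) *\<^sub>C f + c *\<^sub>C f) \<in> A"
    using R[of "h + (d - c) *\<^sub>C f"] by simp
  then show ?thesis
    by (auto simp: scaleC_diff_left algebra_simps)
qed

text \<open>
  The segment from \<open>c\<close> to \<open>d\<close> stays at distance at least \<open>min \<bar>Im c\<bar> \<bar>Im d\<bar>\<close> from the real axis,
  so that finitely many steps shorter than this distance lead from \<open>c\<close> to \<open>d\<close>.
\<close>

lemma symmetric_op_surj_half_plane:
  fixes A :: "('a::complex_hilbert_space \<times> 'a) set"
  assumes lin: "linear_op A" and sym: "symmetric_op A"
    and surj: "\<And>h. \<exists>f. (f, h + c *\<^sub>C f) \<in> A" and same: "Im c * Im d > 0"
  shows "\<exists>f. (f, h + d *\<^sub>C f) \<in> A"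
proof -
  define m where "m = min \<bar>Im c\<bar> \<bar>Im d\<bar>"
  have m: "m > 0" using same by (auto simp: m_def)
  obtain n where n: "cmod (d - c) / m < real n" using reals_Archimedean2 by blast
  then have n0: "real n > 0" using m by (smt (verit) divide_nonneg_pos norm_ge_zero)
  define p where "p k = c + of_real (real k / real n) * (d - c)" for k
  have imp: "\<bar>Im (p k)\<bar> \<ge> m" if "k \<le> n" for k
  proof -
    define t where "t = real k / real n"
    have t: "0 \<le> t" "t \<le> 1" using that n0 by (auto simp: t_def)
    have im: "Im (p k) = (1 - t) * Im c + t * Im d"
      by (simp add: p_def t_def[symmetric] algebra_simps)
    have "\<bar>Im (p k)\<bar> = (1 - t) * \<bar>Im c\<bar> + t * \<bar>Im d\<bar>"
    proof (cases "Im c > 0")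
      case True
      then have "Im d > 0" using same by (simp add: zero_less_mult_iff)
      then show ?thesis using True t unfolding im by (simp add: abs_of_nonneg)
    next
      case False
      then have "Im c < 0" "Im d < 0" using same by (auto simp: zero_less_mult_iff)
      moreover from this have "(1 - t) * Im c + t * Im d \<le> 0"
        using t by (intro add_nonpos_nonpos mult_nonneg_nonpos) auto
      ultimately show ?thesis using t unfolding im by (simp add: abs_of_nonpos)
    qed
    also have "\<dots> \<ge> (1 - t) * m + t * m"
      using t by (intro add_mono mult_left_mono) (auto simp: m_def)
    finally show ?thesis by (simp add: algebra_simps)
  qed
  have "\<exists>f. (f, h + p k *\<^sub>C f) \<in> A" if "k \<le> n" for k h
    using that
  proof (induction k arbitrary: h)
    case 0
    then show ?case using surj by (simp add: p_def)
  next
    case (Suc k)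
    have "p (Suc k) - p k = of_real (1 / real n) * (d - c)"
      using n0 by (simp add: p_def field_simps)
    then have "cmod (p (Suc k) - p k) = cmod (d - c) / real n"
      by (simp add: norm_mult norm_divide)
    also have "\<dots> < m" using n n0 m by (simp add: field_simps)
    finally have "cmod (p (Suc k) - p k) < \<bar>Im (p k)\<bar>"
      using imp[of k] Suc.prems by simp
    moreover have "\<exists>f. (f, h' + p k *\<^sub>C f) \<in> A" for h'
      using Suc by simp
    ultimately show ?case
      by (rule symmetric_op_surj_nearby[OF lin sym, rotated])
  qed
  from this[of n h] show ?thesis using n0 by (simp add: p_def)
qed

text \<open>
  Surjectivity spreads from \<open>cm\<close> to \<open>cnj cp\<close>. Let \<open>(g, g')\<close> be in the adjoint and pick
  \<open>f \<in> dom A\<close> with \<open>(A - cp) f = g' - cp g\<close>; then \<open>g - f\<close> is orthogonal to the range of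
  \<open>A - cnj cp\<close>, which is the whole space.
\<close>

lemma selfadjoint_opI:
  fixes A :: "('a::complex_hilbert_space \<times> 'a) set"
  assumes lin: "linear_op A" and dense: "densely_defined A" and sym: "symmetric_op A"
    and p: "Im cp > 0" "\<And>h. \<exists>f. (f, h + cp *\<^sub>C f) \<in> A"
    and m: "Im cm < 0" "\<And>h. \<exists>f. (f, h + cm *\<^sub>C f) \<in> A"
  shows "selfadjoint_op A"
proof -
  have surj_cnj: "\<exists>f. (f, h + cnj cp *\<^sub>C f) \<in> A" for h
    using m p(1) by (intro symmetric_op_surj_half_plane[OF lin sym m(2)]) (simp add: mult_neg_pos)
  have "(g, g') \<in> A" if g: "(g, g') \<in> op_adjoint A" for g g'
  proof -
    obtain f where "(f, (g' - cp *\<^sub>C g) + cp *\<^sub>C f) \<in> A" using p(2) by blast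
    define f' where "f' = g' - cp *\<^sub>C g + cp *\<^sub>C f"
    have f: "(f, f') \<in> A" unfolding f'_def by fact
    let ?u = "g - f"
    obtain k where k: "(k, ?u + cnj cp *\<^sub>C k) \<in> A" using surj_cnj by blast
    have "cinner (?u + cnj cp *\<^sub>C k) g = cinner k g'"
         "cinner (?u + cnj cp *\<^sub>C k) f = cinner k f'"
      using g k f sym by (auto simp: op_adjoint_def symmetric_op_def)
    then have "cinner (?u + cnj cp *\<^sub>C k) ?u = cinner k (g' - f')"
      by (simp add: cinner_diff_right)
    also have "g' - f' = cp *\<^sub>C ?u" by (simp add: f'_def scaleC_diff_right)
    finally have "cinner ?u ?u = 0"
      by (simp only: cinner_add_left cinner_scaleC_left cinner_scaleC_right) simp
    then have "g = f" by simp
    then show ?thesis using f by (simp add: f'_def)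
  qed
  moreover have "A \<subseteq> op_adjoint A"
    using sym by (auto simp: op_adjoint_def symmetric_op_def)
  ultimately show ?thesis
    using lin dense by (auto simp: selfadjoint_op_def)
qed


section \<open>Quasi boundary triples\<close>

lemma gamma_field_iff:
  "(a, f) \<in> gamma_field T \<Gamma>0 c \<longleftrightarrow> (f, a) \<in> \<Gamma>0 \<and> (f, c *\<^sub>C f) \<in> T"
  by (simp add: gamma_field_def)

lemma weyl_function_iff:
  "(a, b) \<in> weyl_function T \<Gamma>0 \<Gamma>1 c \<longleftrightarrow>
     (\<exists>f. (f, c *\<^sub>C f) \<in> T \<and> (f, a) \<in> \<Gamma>0 \<and> (f, b) \<in> \<Gamma>1)"
  by (auto simp: weyl_function_def op_comp_iff gamma_field_iff)

lemma boundary_op_iff: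
  "(f, f') \<in> boundary_op T \<Gamma>0 \<Gamma>1 B \<longleftrightarrow>
     (f, f') \<in> T \<and> (\<exists>a b. (f, a) \<in> \<Gamma>0 \<and> (f, b) \<in> \<Gamma>1 \<and> (b, a) \<in> B)"
  by (auto simp: boundary_op_def op_comp_iff)

lemma linear_op_boundary_op:
  assumes T: "linear_op T" and G0: "linear_op \<Gamma>0" and G1: "linear_op \<Gamma>1" and B: "linear_op B"
  shows "linear_op (boundary_op T \<Gamma>0 \<Gamma>1 B)"
  unfolding linear_op_def
proof (intro conjI allI impI)
  show "single_valued (boundary_op T \<Gamma>0 \<Gamma>1 B)"
    using linear_op_unique[OF T] by (auto simp: single_valued_def boundary_op_iff)
  show "(0, 0) \<in> boundary_op T \<Gamma>0 \<Gamma>1 B"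
    using assms unfolding boundary_op_iff by (intro conjI exI[of _ 0] linear_op_zero)
  fix x y x' y'
  assume "(x, y) \<in> boundary_op T \<Gamma>0 \<Gamma>1 B" "(x', y') \<in> boundary_op T \<Gamma>0 \<Gamma>1 B"
  then obtain a b a' b' where
    "(x, y) \<in> T" "(x, a) \<in> \<Gamma>0" "(x, b) \<in> \<Gamma>1" "(b, a) \<in> B"
    "(x', y') \<in> T" "(x', a') \<in> \<Gamma>0" "(x', b') \<in> \<Gamma>1" "(b', a') \<in> B"
    unfolding boundary_op_iff by blast
  then have "(x + x', y + y') \<in> T" "(x + x', a + a') \<in> \<Gamma>0" "(x + x', b + b') \<in> \<Gamma>1"
      "(b + b', a + a') \<in> B"
    using assms by (simp_all add: linear_op_add)
  then show "(x + x', y + y') \<in> boundary_op T \<Gamma>0 \<Gamma>1 B"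
    unfolding boundary_op_iff by blast
next
  fix c x y assume "(x, y) \<in> boundary_op T \<Gamma>0 \<Gamma>1 B"
  then obtain a b where "(x, y) \<in> T" "(x, a) \<in> \<Gamma>0" "(x, b) \<in> \<Gamma>1" "(b, a) \<in> B"
    unfolding boundary_op_iff by blast
  then have "(c *\<^sub>C x, c *\<^sub>C y) \<in> T" "(c *\<^sub>C x, c *\<^sub>C a) \<in> \<Gamma>0" "(c *\<^sub>C x, c *\<^sub>C b) \<in> \<Gamma>1"
      "(c *\<^sub>C b, c *\<^sub>C a) \<in> B"
    using assms by (simp_all add: linear_op_scaleC)
  then show "(c *\<^sub>C x, c *\<^sub>C y) \<in> boundary_op T \<Gamma>0 \<Gamma>1 B"
    unfolding boundary_op_iff by blast
qed

locale boundary_triple =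
  fixes S T :: "('h::complex_hilbert_space \<times> 'h) set"
    and \<Gamma>0 \<Gamma>1 :: "('h \<times> 'g::complex_hilbert_space) set"
  assumes quasi_boundary_triple: "quasi_boundary_triple S T \<Gamma>0 \<Gamma>1"
begin

abbreviation "A0 \<equiv> op_restrict T (op_kernel \<Gamma>0)"
abbreviation "A1 \<equiv> op_restrict T (op_kernel \<Gamma>1)"
abbreviation "\<gamma> \<equiv> gamma_field T \<Gamma>0"
abbreviation "M \<equiv> weyl_function T \<Gamma>0 \<Gamma>1"
abbreviation "AB B \<equiv> boundary_op T \<Gamma>0 \<Gamma>1 B"

lemma linear: "linear_op T" "linear_op \<Gamma>0" "linear_op \<Gamma>1"
  and domains: "Domain \<Gamma>0 = Domain T" "Domain \<Gamma>1 = Domain T"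
  and selfadjoint_A0: "selfadjoint_op A0"
  and T_subset_adjoint: "T \<subseteq> op_adjoint S"
  using quasi_boundary_triple by (auto simp: quasi_boundary_triple_def)

lemma green:
  assumes "(f, f') \<in> T" "(f, a0) \<in> \<Gamma>0" "(f, a1) \<in> \<Gamma>1"
    and "(g, g') \<in> T" "(g, b0) \<in> \<Gamma>0" "(g, b1) \<in> \<Gamma>1"
  shows "cinner f' g - cinner f g' = cinner a1 b0 - cinner a0 b1"
  using quasi_boundary_triple assms unfolding quasi_boundary_triple_def by blast

lemma dense_boundary_values:
  "closure {(a0, a1). \<exists>f. (f, a0) \<in> \<Gamma>0 \<and> (f, a1) \<in> \<Gamma>1} = UNIV"
  using quasi_boundary_triple unfolding quasi_boundary_triple_def by blast

lemma boundary_values_exist: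
  assumes "(f, f') \<in> T"
  obtains a0 a1 where "(f, a0) \<in> \<Gamma>0" "(f, a1) \<in> \<Gamma>1"
  using assms domains by blast

lemma dense_range_\<Gamma>0: "closure (Range \<Gamma>0) = UNIV"
proof -
  let ?P = "{(a0, a1). \<exists>f. (f, a0) \<in> \<Gamma>0 \<and> (f, a1) \<in> \<Gamma>1}"
  have "fst ` closure ?P \<subseteq> closure (fst ` ?P)"
    by (intro image_closure_subset closure_subset closed_closure continuous_on_fst continuous_on_id)
  also have "\<dots> \<subseteq> closure (Range \<Gamma>0)"
    by (intro closure_mono) auto
  finally show ?thesis
    unfolding dense_boundary_values by (simp add: top.extremum_unique)
qed

text \<open>
  \<open>S \<subseteq> A0\<close> since \<open>A0\<close> is a restriction of the adjoint of \<open>S\<close> and equals its own adjoint. On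
  \<open>dom S\<close> the left-hand side of Green's identity vanishes, and density of the boundary values gives
  \<open>\<Gamma>1 = 0\<close> there.
\<close>

lemma minimal_operator:
  assumes f: "(f, f') \<in> S"
  shows "(f, f') \<in> T" "(f, 0) \<in> \<Gamma>0" "(f, 0) \<in> \<Gamma>1"
proof -
  have "(f, f') \<in> op_adjoint A0"
    unfolding op_adjoint_def
  proof (clarify)
    fix g g' assume "(g, g') \<in> A0"
    then have "(g, g') \<in> op_adjoint S" using T_subset_adjoint by auto
    then have "cinner f' g = cinner f g'" using f by (auto simp: op_adjoint_def)
    then show "cinner g' f = cinner g f'"
      using cinner_commute by metis
  qed
  then have "(f, f') \<in> A0"
    using selfadjoint_A0 by (simp add: selfadjoint_op_def)
  then show T: "(f, f') \<in> T" and G0: "(f, 0) \<in> \<Gamma>0" by auto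
  obtain a where a: "(f, a) \<in> \<Gamma>1" using boundary_values_exist[OF T] by blast
  have "a = 0"
  proof (rule orthogonal_to_dense_set[OF dense_range_\<Gamma>0])
    fix b assume "b \<in> Range \<Gamma>0"
    then obtain g where g0: "(g, b) \<in> \<Gamma>0" by blast
    then obtain g' b1 where g: "(g, g') \<in> T" "(g, b1) \<in> \<Gamma>1" using domains by blast
    have "cinner f' g = cinner f g'"
      using f g(1) T_subset_adjoint by (auto simp: op_adjoint_def)
    then have "cinner a b = 0" using green[OF T G0 a g(1) g0 g(2)] by simp
    then show "cinner b a = 0" using cinner_commute[of b a] by simp
  qed
  then show "(f, 0) \<in> \<Gamma>1" using a by simp
qed

lemma minimal_operator_subset_AB: "linear_op B \<Longrightarrow> S \<subseteq> AB B"
  using minimal_operator linear_op_zero by (fastforce simp: boundary_op_iff)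

lemma symmetric_AB:
  assumes "symmetric_op B"
  shows "symmetric_op (AB B)"
  unfolding symmetric_op_def
proof (intro allI impI)
  fix f f' g g' assume "(f, f') \<in> AB B" "(g, g') \<in> AB B"
  then obtain a0 a1 b0 b1 where f: "(f, f') \<in> T" "(f, a0) \<in> \<Gamma>0" "(f, a1) \<in> \<Gamma>1" "(a1, a0) \<in> B"
    and g: "(g, g') \<in> T" "(g, b0) \<in> \<Gamma>0" "(g, b1) \<in> \<Gamma>1" "(b1, b0) \<in> B"
    unfolding boundary_op_iff by blast
  then have "cinner a0 b1 = cinner a1 b0"
    using assms by (auto simp: symmetric_op_def)
  then show "cinner f' g = cinner f g'"
    using green[OF f(1-3) g(1-3)] by simp
qed

text \<open>
  The decompositions of \<open>dom T\<close> into \<open>ker \<Gamma>0\<close>, or \<open>ker \<Gamma>1\<close>, and \<open>ker (T - c)\<close>, which leave the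
  respective boundary value to the second summand.
\<close>

lemma range_\<Gamma>0_attained:
  assumes surj: "\<And>h. \<exists>k. (k, h + c *\<^sub>C k) \<in> A0" and a: "a \<in> Range \<Gamma>0"
  obtains f where "(f, a) \<in> \<Gamma>0" "(f, c *\<^sub>C f) \<in> T"
proof -
  obtain g where g0: "(g, a) \<in> \<Gamma>0" using a by blast
  then obtain g' where g: "(g, g') \<in> T" using domains by blast
  obtain k where k: "(k, (g' - c *\<^sub>C g) + c *\<^sub>C k) \<in> A0" using surj by blast
  show thesis
  proof
    show "(g - k, a) \<in> \<Gamma>0"
      using linear_op_diff[OF linear(2) g0, of k 0] k by simp
    show "(g - k, c *\<^sub>C (g - k)) \<in> T"
      using linear_op_diff[OF linear(1) g, of k "(g' - c *\<^sub>C g) + c *\<^sub>C k"] k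
      by (simp add: scaleC_diff_right)
  qed
qed

lemma range_\<Gamma>1_attained:
  assumes surj: "\<And>h. \<exists>k. (k, h + c *\<^sub>C k) \<in> A1" and b: "b \<in> Range \<Gamma>1"
  shows "b \<in> Range (M c)"
proof -
  obtain g where g1: "(g, b) \<in> \<Gamma>1" using b by blast
  then obtain g' where g: "(g, g') \<in> T" using domains by blast
  obtain k where k: "(k, (g' - c *\<^sub>C g) + c *\<^sub>C k) \<in> A1" using surj by blast
  have "(g - k, b) \<in> \<Gamma>1"
    using linear_op_diff[OF linear(3) g1, of k 0] k by simp
  moreover have T: "(g - k, c *\<^sub>C (g - k)) \<in> T"
    using linear_op_diff[OF linear(1) g, of k "(g' - c *\<^sub>C g) + c *\<^sub>C k"] k
    by (simp add: scaleC_diff_right)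
  moreover obtain a where "(g - k, a) \<in> \<Gamma>0" using boundary_values_exist[OF T] by blast
  ultimately show ?thesis unfolding Range_iff weyl_function_iff by blast
qed

lemma Domain_weyl_function:
  assumes surj: "\<And>h. \<exists>k. (k, h + c *\<^sub>C k) \<in> A0"
  shows "Domain (M c) = Range \<Gamma>0"
proof (intro subset_antisym subsetI)
  show "a \<in> Range \<Gamma>0" if "a \<in> Domain (M c)" for a
    using that by (auto simp: weyl_function_iff)
  fix a assume "a \<in> Range \<Gamma>0"
  then obtain f where f: "(f, a) \<in> \<Gamma>0" "(f, c *\<^sub>C f) \<in> T"
    using range_\<Gamma>0_attained[OF surj] by blast
  moreover obtain b where "(f, b) \<in> \<Gamma>1" using boundary_values_exist[OF f(2)] by blast
  ultimately show "a \<in> Domain (M c)"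
    unfolding Domain_iff weyl_function_iff by blast
qed

text \<open>
  Green's identity for \<open>f \<in> ker (T - c)\<close> and \<open>g \<in> ker (T - cnj c)\<close> puts \<open>M c\<close> below the adjoint of
  the densely defined \<open>M (cnj c)\<close>, which is single-valued and closed; hence \<open>M c\<close> is closable.
\<close>

lemma weyl_function_closable:
  assumes c: "Im c \<noteq> 0" and b: "(a, b) \<in> closure (M c)" and b': "(a, b') \<in> M c"
  shows "b = b'"
proof (rule op_adjoint_unique)
  have "M c \<subseteq> op_adjoint (M (cnj c))"
  proof (clarify)
    fix p q assume "(p, q) \<in> M c"
    then obtain f where f: "(f, c *\<^sub>C f) \<in> T" "(f, p) \<in> \<Gamma>0" "(f, q) \<in> \<Gamma>1"
      by (auto simp: weyl_function_iff)
    show "(p, q) \<in> op_adjoint (M (cnj c))"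
      unfolding op_adjoint_def
    proof (clarify)
      fix r s assume "(r, s) \<in> M (cnj c)"
      then obtain g where g: "(g, cnj c *\<^sub>C g) \<in> T" "(g, r) \<in> \<Gamma>0" "(g, s) \<in> \<Gamma>1"
        by (auto simp: weyl_function_iff)
      show "cinner s p = cinner r q"
        using green[OF g f] by (simp add: cinner_scaleC_left cinner_scaleC_right)
    qed
  qed
  moreover from this have "closure (M c) \<subseteq> op_adjoint (M (cnj c))"
    by (rule closure_minimal[OF _ closed_op_adjoint])
  ultimately show "(a, b) \<in> op_adjoint (M (cnj c))" "(a, b') \<in> op_adjoint (M (cnj c))"
    using b b' by auto
  have "Domain (M (cnj c)) = Range \<Gamma>0"
    using c by (intro Domain_weyl_function selfadjoint_op_surj[OF selfadjoint_A0]) simp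
  then show "densely_defined (M (cnj c))"
    by (simp add: densely_defined_def dense_range_\<Gamma>0)
qed

text \<open>
  The ansatz \<open>f = (A0 - c)\<inverse> h + \<gamma> c a\<close> solves the boundary value problem iff
  \<open>a - B (M c a) = B (\<Gamma>1 ((A0 - c)\<inverse> h))\<close>. The closure of \<open>M c\<close> makes this equation solvable; the
  mapping properties of \<open>B\<close> show afterwards that \<open>a\<close> lies in \<open>ran \<Gamma>0\<close>, the domain of \<open>M c\<close>
  itself.
\<close>

lemma surj_AB:
  assumes B: "linear_op B" and c: "Im c \<noteq> 0"
    and rho: "1 \<in> resolvent_set (B \<circ>\<^sub>o closure (M c))"
    and BM: "B `` (Range (closure (M c)) \<inter> Domain B) \<subseteq> Range \<Gamma>0"
    and dom: "Range \<Gamma>1 \<subseteq> Domain B"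
    and BG: "B `` Range \<Gamma>1 \<subseteq> Range \<Gamma>0 \<or> selfadjoint_op A1"
  shows "\<exists>f. (f, h + c *\<^sub>C f) \<in> AB B"
proof -
  have surj0: "\<exists>k. (k, h + c *\<^sub>C k) \<in> A0" for h
    by (rule selfadjoint_op_surj[OF selfadjoint_A0 c])
  have BG: "B `` Range \<Gamma>1 \<subseteq> Range \<Gamma>0"
    using BG
  proof
    assume sa: "selfadjoint_op A1"
    have "Range \<Gamma>1 \<subseteq> Range (M c)"
      by (intro subsetI range_\<Gamma>1_attained selfadjoint_op_surj[OF sa c])
    then have "Range \<Gamma>1 \<subseteq> Range (closure (M c)) \<inter> Domain B"
      using dom Range_mono[OF closure_subset[of "M c"]] by blast
    then show ?thesis using BM by blast
  qed
  obtain f0 where f0: "(f0, h + c *\<^sub>C f0) \<in> T" "(f0, 0) \<in> \<Gamma>0"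
    using surj0[of h] by auto
  obtain b0 where b0: "(f0, b0) \<in> \<Gamma>1" using boundary_values_exist[OF f0(1)] by blast
  then have "b0 \<in> Domain B" by (intro subsetD[OF dom] RangeI)
  then obtain e where e: "(b0, e) \<in> B" by blast
  obtain a where "(a, - e + 1 *\<^sub>C a) \<in> B \<circ>\<^sub>o closure (M c)"
    using resolvent_set_surj[OF rho] by blast
  then obtain b where b: "(a, b) \<in> closure (M c)" "(b, a - e) \<in> B"
    by (auto simp: op_comp_iff)
  have "a - e \<in> Range \<Gamma>0" "e \<in> Range \<Gamma>0"
    using BM BG b e b0 by blast+
  then obtain x y where "(x, a - e) \<in> \<Gamma>0" "(y, e) \<in> \<Gamma>0" by blast
  from linear_op_add[OF linear(2) this] have "a \<in> Range \<Gamma>0" by auto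
  then obtain g where g: "(g, a) \<in> \<Gamma>0" "(g, c *\<^sub>C g) \<in> T"
    using range_\<Gamma>0_attained[OF surj0] by blast
  obtain b' where b': "(g, b') \<in> \<Gamma>1" using boundary_values_exist[OF g(2)] by blast
  have "(a, b') \<in> M c"
    using g b' by (auto simp: weyl_function_iff)
  then have "b' = b"
    using weyl_function_closable[OF c b(1)] by simp
  have "(f0 + g, h + c *\<^sub>C (f0 + g)) \<in> T"
    using linear_op_add[OF linear(1) f0(1) g(2)] by (simp add: scaleC_add_right add.assoc)
  moreover have "(f0 + g, a) \<in> \<Gamma>0"
    using linear_op_add[OF linear(2) f0(2) g(1)] by simp
  moreover have "(f0 + g, b0 + b) \<in> \<Gamma>1"
    using linear_op_add[OF linear(3) b0 b'] \<open>b' = b\<close> by simp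
  moreover have "(b0 + b, a) \<in> B"
    using linear_op_add[OF B e b(2)] by simp
  ultimately show ?thesis
    by (auto simp: boundary_op_iff)
qed

text \<open>
  The adjoint of \<open>\<gamma> (cnj c)\<close> is \<open>\<Gamma>1 (A0 - c)\<inverse>\<close>, by Green's identity for \<open>\<gamma> (cnj c) a\<close> and
  \<open>(A0 - c)\<inverse> h\<close>.
\<close>

lemma adjoint_gamma_field_iff:
  assumes rho: "c \<in> resolvent_set A0" and k: "(k, h + c *\<^sub>C k) \<in> A0"
  shows "(h, b) \<in> op_adjoint (\<gamma> (cnj c)) \<longleftrightarrow> (k, b) \<in> \<Gamma>1"
proof -
  have surj_cnj: "\<exists>k. (k, h + cnj c *\<^sub>C k) \<in> A0" for h
  proof (cases "Im c = 0")
    case True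
    then have "cnj c = c" by (simp add: complex_eq_iff)
    then show ?thesis using resolvent_set_surj[OF rho] by simp
  next
    case False
    then show ?thesis by (intro selfadjoint_op_surj[OF selfadjoint_A0]) simp
  qed
  have adj: "(h, b1) \<in> op_adjoint (\<gamma> (cnj c))" if b1: "(k, b1) \<in> \<Gamma>1" for b1
    unfolding op_adjoint_def
  proof (clarify)
    fix a f assume "(a, f) \<in> \<gamma> (cnj c)"
    then have f: "(f, a) \<in> \<Gamma>0" "(f, cnj c *\<^sub>C f) \<in> T" by (auto simp: gamma_field_iff)
    obtain a1 where a1: "(f, a1) \<in> \<Gamma>1" using boundary_values_exist[OF f(2)] by blast
    show "cinner f h = cinner a b1"
      using green[OF f(2,1) a1 _ _ b1, of "h + c *\<^sub>C k" 0] k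
      by (simp add: cinner_scaleC_left cinner_scaleC_right cinner_add_right)
  qed
  have dense: "densely_defined (\<gamma> (cnj c))"
  proof -
    have "Range \<Gamma>0 \<subseteq> Domain (\<gamma> (cnj c))"
      using range_\<Gamma>0_attained[OF surj_cnj] by (metis DomainI gamma_field_iff subsetI)
    then show ?thesis
      unfolding densely_defined_def using dense_range_\<Gamma>0 closure_mono by blast
  qed
  have "(k, h + c *\<^sub>C k) \<in> T" using k by simp
  then obtain b1 where b1: "(k, b1) \<in> \<Gamma>1" by (rule boundary_values_exist)
  then show ?thesis
    using adj op_adjoint_unique[OF dense] by blast
qed

text \<open>
  The difference \<open>a\<close> of two solutions of the same equation satisfies \<open>a = B (M c a)\<close>, so that
  \<open>\<gamma> c a\<close> lies in the kernel of \<open>AB - c\<close>.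
\<close>

lemma one_minus_BM_injective:
  assumes B: "linear_op B" and rho: "c \<in> resolvent_set (AB B)"
  shows "single_valued ((scalar_op 1 -\<^sub>o B \<circ>\<^sub>o M c)\<inverse>)"
proof (rule single_valuedI)
  fix e a a' assume "(e, a) \<in> (scalar_op 1 -\<^sub>o B \<circ>\<^sub>o M c)\<inverse>" "(e, a') \<in> (scalar_op 1 -\<^sub>o B \<circ>\<^sub>o M c)\<inverse>"
  then have "(a, a - e) \<in> B \<circ>\<^sub>o M c" "(a', a' - e) \<in> B \<circ>\<^sub>o M c"
    by (auto simp: one_minus_op_iff)
  then obtain b b' f f' where f: "(f, c *\<^sub>C f) \<in> T" "(f, a) \<in> \<Gamma>0" "(f, b) \<in> \<Gamma>1" "(b, a - e) \<in> B"
    and f': "(f', c *\<^sub>C f') \<in> T" "(f', a') \<in> \<Gamma>0" "(f', b') \<in> \<Gamma>1" "(b', a' - e) \<in> B"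
    by (auto simp: op_comp_iff weyl_function_iff)
  have "(f - f', c *\<^sub>C (f - f')) \<in> T" "(f - f', a - a') \<in> \<Gamma>0" "(f - f', b - b') \<in> \<Gamma>1"
      "(b - b', a - a') \<in> B"
    using linear_op_diff[OF linear(1) f(1) f'(1)] linear_op_diff[OF linear(2) f(2) f'(2)]
      linear_op_diff[OF linear(3) f(3) f'(3)] linear_op_diff[OF B f(4) f'(4)]
    by (simp_all add: scaleC_diff_right)
  then have "(f - f', c *\<^sub>C (f - f')) \<in> AB B"
    by (auto simp: boundary_op_iff)
  then have "f - f' = 0" using resolvent_set_inj[OF rho] by blast
  then show "a = a'"
    using linear_op_unique[OF linear(2) f(2)] f'(2) by simp
qed

text \<open>
  Compare a solution \<open>f\<close> of \<open>(AB - c) f = h\<close> with \<open>k = (A0 - c)\<inverse> h\<close>: the difference lies in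
  \<open>ker (T - c)\<close>, hence is \<open>\<gamma> c a\<close> with \<open>a = \<Gamma>0 f\<close>, and the boundary condition for \<open>f\<close> is the equation
  \<open>(I - B (M c)) a = B (\<Gamma>1 k)\<close>. The assumption on \<open>dom B\<close> allows \<open>B\<close> to be applied to \<open>\<Gamma>1 k\<close> and to
  \<open>M c a\<close> separately.
\<close>

lemma krein_formula:
  assumes B: "linear_op B" and dom: "Range \<Gamma>1 \<subseteq> Domain B" and rho: "c \<in> resolvent_set A0"
  shows "resolvent (AB B) c = resolvent A0 c +\<^sub>o
    \<gamma> c \<circ>\<^sub>o (scalar_op 1 -\<^sub>o B \<circ>\<^sub>o M c)\<inverse> \<circ>\<^sub>o B \<circ>\<^sub>o op_adjoint (\<gamma> (cnj c))"
    (is "_ = _ +\<^sub>o ?K")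
proof -
  have K: "(h, g) \<in> ?K \<longleftrightarrow> (\<exists>p e a q. (k, p) \<in> \<Gamma>1 \<and> (p, e) \<in> B \<and> (a, q) \<in> M c \<and>
      (q, a - e) \<in> B \<and> (g, a) \<in> \<Gamma>0 \<and> (g, c *\<^sub>C g) \<in> T)"
    if k: "(k, h + c *\<^sub>C k) \<in> A0" for h g k
    by (auto simp: op_comp_iff gamma_field_iff one_minus_op_iff adjoint_gamma_field_iff[OF rho k])
  show ?thesis
  proof (intro set_eqI iffI; clarify)
    fix h f assume "(h, f) \<in> resolvent (AB B) c"
    then have "(f, h + c *\<^sub>C f) \<in> AB B" by (simp add: resolvent_iff)
    then obtain a b where f: "(f, h + c *\<^sub>C f) \<in> T" "(f, a) \<in> \<Gamma>0" "(f, b) \<in> \<Gamma>1" "(b, a) \<in> B"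
      by (auto simp: boundary_op_iff)
    obtain k where k: "(k, h + c *\<^sub>C k) \<in> A0" using resolvent_set_surj[OF rho] by blast
    then have kT: "(k, h + c *\<^sub>C k) \<in> T" "(k, 0) \<in> \<Gamma>0" by auto
    obtain p where p: "(k, p) \<in> \<Gamma>1" using boundary_values_exist[OF kT(1)] by blast
    then obtain e where e: "(p, e) \<in> B" using dom by blast
    have g: "(f - k, c *\<^sub>C (f - k)) \<in> T" "(f - k, a) \<in> \<Gamma>0" "(f - k, b - p) \<in> \<Gamma>1"
      using linear_op_diff[OF linear(1) f(1) kT(1)] linear_op_diff[OF linear(2) f(2) kT(2)]
        linear_op_diff[OF linear(3) f(3) p] by (simp_all add: scaleC_diff_right)
    have "(a, b - p) \<in> M c" using g by (auto simp: weyl_function_iff)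
    moreover have "(b - p, a - e) \<in> B" by (rule linear_op_diff[OF B f(4) e])
    ultimately have "(h, f - k) \<in> ?K" using K[OF k] p e g by blast
    moreover have "(h, k) \<in> resolvent A0 c" using k by (simp add: resolvent_iff)
    ultimately have "(h, k + (f - k)) \<in> resolvent A0 c +\<^sub>o ?K"
      unfolding op_plus_def by blast
    then show "(h, f) \<in> resolvent A0 c +\<^sub>o ?K" by simp
  next
    fix h f assume "(h, f) \<in> resolvent A0 c +\<^sub>o ?K"
    then obtain k g where f: "f = k + g" and "(h, k) \<in> resolvent A0 c" and g: "(h, g) \<in> ?K"
      unfolding op_plus_def by blast
    then have k: "(k, h + c *\<^sub>C k) \<in> A0" by (simp add: resolvent_iff)
    then have kT: "(k, h + c *\<^sub>C k) \<in> T" "(k, 0) \<in> \<Gamma>0" by auto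
    obtain p e a q where p: "(k, p) \<in> \<Gamma>1" "(p, e) \<in> B" "(a, q) \<in> M c" "(q, a - e) \<in> B"
        "(g, a) \<in> \<Gamma>0" "(g, c *\<^sub>C g) \<in> T"
      using g K[OF k] by blast
    from p(3) obtain g' where g': "(g', c *\<^sub>C g') \<in> T" "(g', a) \<in> \<Gamma>0" "(g', q) \<in> \<Gamma>1"
      by (auto simp: weyl_function_iff)
    \<comment> \<open>\<open>\<Gamma>0\<close> is injective on the kernel of \<open>T - c\<close>\<close>
    have "(g - g', c *\<^sub>C (g - g')) \<in> A0"
      using linear_op_diff[OF linear(1) p(6) g'(1)] linear_op_diff[OF linear(2) p(5) g'(2)]
      by (simp add: scaleC_diff_right)
    then have "g = g'" using resolvent_set_inj[OF rho] by force
    have "(f, h + c *\<^sub>C f) \<in> T" "(f, a) \<in> \<Gamma>0" "(f, p + q) \<in> \<Gamma>1" "(p + q, a) \<in> B"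
      using linear_op_add[OF linear(1) kT(1) p(6)] linear_op_add[OF linear(2) kT(2) p(5)]
        linear_op_add[OF linear(3) p(1) g'(3)] linear_op_add[OF B p(2,4)] \<open>g = g'\<close>
      by (simp_all add: f scaleC_add_right add.assoc)
    then have "(f, h + c *\<^sub>C f) \<in> AB B" by (auto simp: boundary_op_iff)
    then show "(h, f) \<in> resolvent (AB B) c" by (simp add: resolvent_iff)
  qed
qed

end


section \<open>Self-adjointness and Krein's formula\<close>

theorem theorem2p4:
  fixes S T :: "('h::complex_hilbert_space \<times> 'h) set"
    and \<Gamma>0 \<Gamma>1 :: "('h \<times> 'g::complex_hilbert_space) set"
    and B :: "('g \<times> 'g) set"
    and A0 A1 AB :: "('h \<times> 'h) set"
    and \<gamma> :: "complex \<Rightarrow> ('g \<times> 'h) set"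
    and M :: "complex \<Rightarrow> ('g \<times> 'g) set"
    and \<mu>p \<mu>m :: complex
  defines "A0 \<equiv> op_restrict T (op_kernel \<Gamma>0)"
    and "A1 \<equiv> op_restrict T (op_kernel \<Gamma>1)"
    and "\<gamma> \<equiv> gamma_field T \<Gamma>0"
    and "M \<equiv> weyl_function T \<Gamma>0 \<Gamma>1"
    and "AB \<equiv> boundary_op T \<Gamma>0 \<Gamma>1 B"
  assumes "linear_op S" and "densely_defined S" and "closed S" and "symmetric_op S"
    and "quasi_boundary_triple S T \<Gamma>0 \<Gamma>1"
    and "linear_op B"
    and "Im \<mu>p > 0" and "Im \<mu>m < 0"
    and i: "symmetric_op B"
    and ii: "\<forall>\<mu>\<in>{\<mu>p, \<mu>m}. 1 \<in> resolvent_set (B \<circ>\<^sub>o closure (M \<mu>))"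
    and iii: "\<forall>\<mu>\<in>{\<mu>p, \<mu>m}. B `` (Range (closure (M \<mu>)) \<inter> Domain B) \<subseteq> Range \<Gamma>0"
    and iv: "Range \<Gamma>1 \<subseteq> Domain B"
    and v: "B `` Range \<Gamma>1 \<subseteq> Range \<Gamma>0 \<or> selfadjoint_op A1"
  shows "selfadjoint_op AB \<and> S \<subseteq> AB \<and>
    (\<forall>\<mu> \<in> resolvent_set AB \<inter> resolvent_set A0.
       single_valued ((scalar_op 1 -\<^sub>o B \<circ>\<^sub>o M \<mu>)\<inverse>) \<and>
       resolvent AB \<mu> =
         resolvent A0 \<mu> +\<^sub>o
         \<gamma> \<mu> \<circ>\<^sub>o (scalar_op 1 -\<^sub>o B \<circ>\<^sub>o M \<mu>)\<inverse> \<circ>\<^sub>o B \<circ>\<^sub>o op_adjoint (\<gamma> (cnj \<mu>)))"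
proof -
  interpret boundary_triple S T \<Gamma>0 \<Gamma>1
    by unfold_locales fact
  have surj: "\<exists>f. (f, h + \<mu> *\<^sub>C f) \<in> AB" if "\<mu> \<in> {\<mu>p, \<mu>m}" for h \<mu>
    unfolding AB_def
  proof (rule surj_AB)
    show "Im \<mu> \<noteq> 0" using that \<open>Im \<mu>p > 0\<close> \<open>Im \<mu>m < 0\<close> by auto
  qed (use that ii iii iv v \<open>linear_op B\<close> in \<open>unfold M_def A1_def, blast+\<close>)
  have ext: "S \<subseteq> AB"
    unfolding AB_def by (rule minimal_operator_subset_AB) fact
  then have "Domain S \<subseteq> Domain AB" by blast
  then have dense: "densely_defined AB"
    using \<open>densely_defined S\<close> closure_mono unfolding densely_defined_def by blast
  have "selfadjoint_op AB"
  proof (rule selfadjoint_opI)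
    show "linear_op AB"
      unfolding AB_def by (intro linear_op_boundary_op linear) fact
    show "symmetric_op AB"
      unfolding AB_def by (rule symmetric_AB[OF i])
  qed (use dense surj \<open>Im \<mu>p > 0\<close> \<open>Im \<mu>m < 0\<close> in auto)
  moreover have "single_valued ((scalar_op 1 -\<^sub>o B \<circ>\<^sub>o M \<mu>)\<inverse>)"
    if "\<mu> \<in> resolvent_set AB" for \<mu>
    using that unfolding AB_def M_def by (rule one_minus_BM_injective[OF \<open>linear_op B\<close>])
  moreover have "resolvent AB \<mu> = resolvent A0 \<mu> +\<^sub>o
      \<gamma> \<mu> \<circ>\<^sub>o (scalar_op 1 -\<^sub>o B \<circ>\<^sub>o M \<mu>)\<inverse> \<circ>\<^sub>o B \<circ>\<^sub>o op_adjoint (\<gamma> (cnj \<mu>))"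
    if "\<mu> \<in> resolvent_set A0" for \<mu>
    using that unfolding AB_def M_def \<gamma>_def A0_def by (rule krein_formula[OF \<open>linear_op B\<close> iv])
  ultimately show ?thesis using ext by blast
qed

end
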